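(* The idempotent equation $css=cs$ and the previous redundant equation $csts=cts$ (where $c$ is a variable of sort $C$ and $s,t$ are variables of sort $S$) axiomatize the equational theory of $\uparrow\downarrow$-actions. That is, an equation between two terms of the same sort in the two-sorted language of actions holds universally in all $\uparrow\downarrow$-actions if and only if it is a consequence of these two equations.
   Context: An action $(C,S)$ consists of sets $C$, $S$ and a function $f\colon C\times S\to C$; write $cs$ for $f(c,s)$ and associate to the left. It is regarded as an algebra in a two-sorted signature (sorts $C$ and $S$) with a single function symbol $f$. Thus the terms of sort $S$ are single variables, and the terms of sort $C$ are of the form $cs_1\cdots s_n$ ($n\ge 0$) with $c$ a variable of sort $C$ and $s_1,\dots,s_n$ variables of sort $S$. For a set $X$, the full $\uparrow\downarrow$-action $F(X)$ on $X$ is the action with $C=\{c\mid c\subseteq X\}$, $S=\{(s^\downarrow,s^\uparrow)\mid s^\uparrow\subseteq s^\downarrow\subseteq X\}$ and $c\,(s^\downarrow,s^\uparrow)=(c\cap s^\downarrow)\cup s^\uparrow$. An action is an $\uparrow\downarrow$-action if it is isomorphic to a (two-sorted) subalgebra of $F(X)$ for some set $X$. *)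

theory Defs
  imports Main
begin

section \<open>Actions\<close>

text \<open>The function is only relevant on the carriers, which may be empty.\<close>

record ('c, 's) action =
  carC :: "'c set"
  carS :: "'s set"
  act :: "'c \<Rightarrow> 's \<Rightarrow> 'c"

definition is_action :: "('c, 's) action \<Rightarrow> bool" where
  "is_action A \<longleftrightarrow> (\<forall>c\<in>carC A. \<forall>s\<in>carS A. act A c s \<in> carC A)"

definition subaction :: "('c, 's) action \<Rightarrow> ('c, 's) action \<Rightarrow> bool" where
  "subaction B A \<longleftrightarrow> is_action B \<and> carC B \<subseteq> carC A \<and> carS B \<subseteq> carS A \<and>
     (\<forall>c\<in>carC B. \<forall>s\<in>carS B. act B c s = act A c s)"

definition action_iso :: "('c, 's) action \<Rightarrow> ('d, 't) action \<Rightarrow> bool" where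
  "action_iso A B \<longleftrightarrow>
     (\<exists>\<phi> \<psi>. bij_betw \<phi> (carC A) (carC B) \<and> bij_betw \<psi> (carS A) (carS B) \<and>
        (\<forall>c\<in>carC A. \<forall>s\<in>carS A. \<phi> (act A c s) = act B (\<phi> c) (\<psi> s)))"

text \<open>An element of sort \<open>S\<close> is the pair \<open>(d, u)\<close> of its down part and its up part.\<close>

definition full_action :: "'x set \<Rightarrow> ('x set, 'x set \<times> 'x set) action" where
  "full_action X =
     \<lparr>carC = Pow X, carS = {(d, u). u \<subseteq> d \<and> d \<subseteq> X}, act = (\<lambda>c (d, u). (c \<inter> d) \<union> u)\<rparr>"

text \<open>The type argument only names the type over which the set \<open>X\<close> ranges.\<close>

definition updown_action :: "'x itself \<Rightarrow> ('c, 's) action \<Rightarrow> bool" where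
  "updown_action (_ :: 'x itself) A \<longleftrightarrow>
     is_action A \<and> (\<exists>(X :: 'x set) B. subaction B (full_action X) \<and> action_iso A B)"

section \<open>Terms and equations\<close>

datatype sterm = SVar nat

datatype cterm = CVar nat | App cterm sterm  (infixl \<open>\<cdot>\<close> 70)

datatype equation = CEq cterm cterm | SEq sterm sterm

primrec svars_s :: "sterm \<Rightarrow> nat set" where
  "svars_s (SVar y) = {y}"

primrec cvars_c :: "cterm \<Rightarrow> nat set" where
  "cvars_c (CVar x) = {x}"
| "cvars_c (t \<cdot> s) = cvars_c t"

primrec svars_c :: "cterm \<Rightarrow> nat set" where
  "svars_c (CVar x) = {}"
| "svars_c (t \<cdot> s) = svars_c t \<union> svars_s s"

primrec cvars_eq :: "equation \<Rightarrow> nat set" where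
  "cvars_eq (CEq t u) = cvars_c t \<union> cvars_c u"
| "cvars_eq (SEq s r) = {}"

primrec svars_eq :: "equation \<Rightarrow> nat set" where
  "svars_eq (CEq t u) = svars_c t \<union> svars_c u"
| "svars_eq (SEq s r) = svars_s s \<union> svars_s r"

section \<open>Satisfaction and semantic consequence\<close>

primrec eval_s :: "(nat \<Rightarrow> 's) \<Rightarrow> sterm \<Rightarrow> 's" where
  "eval_s \<sigma> (SVar y) = \<sigma> y"

primrec eval_c :: "('c, 's) action \<Rightarrow> (nat \<Rightarrow> 'c) \<Rightarrow> (nat \<Rightarrow> 's) \<Rightarrow> cterm \<Rightarrow> 'c" where
  "eval_c A \<rho> \<sigma> (CVar x) = \<rho> x"
| "eval_c A \<rho> \<sigma> (t \<cdot> s) = act A (eval_c A \<rho> \<sigma> t) (eval_s \<sigma> s)"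

primrec holds_at :: "('c, 's) action \<Rightarrow> (nat \<Rightarrow> 'c) \<Rightarrow> (nat \<Rightarrow> 's) \<Rightarrow> equation \<Rightarrow> bool" where
  "holds_at A \<rho> \<sigma> (CEq t u) \<longleftrightarrow> eval_c A \<rho> \<sigma> t = eval_c A \<rho> \<sigma> u"
| "holds_at A \<rho> \<sigma> (SEq s r) \<longleftrightarrow> eval_s \<sigma> s = eval_s \<sigma> r"

text \<open>Only the variables occurring in the equation are required to take values in the
  carriers; otherwise an action with an empty sort \<open>S\<close> would satisfy every equation vacuously,
  including those without variables of sort \<open>S\<close>.\<close>

definition satisfies :: "('c, 's) action \<Rightarrow> equation \<Rightarrow> bool" where
  "satisfies A e \<longleftrightarrow>
     (\<forall>\<rho> \<sigma>. (\<forall>x\<in>cvars_eq e. \<rho> x \<in> carC A) \<longrightarrow> (\<forall>y\<in>svars_eq e. \<sigma> y \<in> carS A) \<longrightarrow>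
        holds_at A \<rho> \<sigma> e)"

text \<open>HOL cannot quantify over types inside a formula, so the arguments of type \<open>'c itself\<close> and
  \<open>'s itself\<close> name the universes
  from which the carriers of the models are taken.\<close>

definition updown_valid :: "'x itself \<Rightarrow> 'c itself \<Rightarrow> 's itself \<Rightarrow> equation \<Rightarrow> bool" where
  "updown_valid (X :: 'x itself) (_ :: 'c itself) (_ :: 's itself) e \<longleftrightarrow>
     (\<forall>A :: ('c, 's) action. updown_action X A \<longrightarrow> satisfies A e)"

definition semantic_consequence ::
    "'c itself \<Rightarrow> 's itself \<Rightarrow> equation set \<Rightarrow> equation \<Rightarrow> bool" where
  "semantic_consequence (_ :: 'c itself) (_ :: 's itself) E e \<longleftrightarrow>
     (\<forall>A :: ('c, 's) action. is_action A \<longrightarrow> (\<forall>d\<in>E. satisfies A d) \<longrightarrow> satisfies A e)"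

section \<open>Equational derivability\<close>

primrec subst_s :: "(nat \<Rightarrow> sterm) \<Rightarrow> sterm \<Rightarrow> sterm" where
  "subst_s \<tau> (SVar y) = \<tau> y"

primrec subst_c :: "(nat \<Rightarrow> cterm) \<Rightarrow> (nat \<Rightarrow> sterm) \<Rightarrow> cterm \<Rightarrow> cterm" where
  "subst_c \<theta> \<tau> (CVar x) = \<theta> x"
| "subst_c \<theta> \<tau> (t \<cdot> s) = subst_c \<theta> \<tau> t \<cdot> subst_s \<tau> s"

primrec subst_eq :: "(nat \<Rightarrow> cterm) \<Rightarrow> (nat \<Rightarrow> sterm) \<Rightarrow> equation \<Rightarrow> equation" where
  "subst_eq \<theta> \<tau> (CEq t u) = CEq (subst_c \<theta> \<tau> t) (subst_c \<theta> \<tau> u)"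
| "subst_eq \<theta> \<tau> (SEq s r) = SEq (subst_s \<tau> s) (subst_s \<tau> r)"

inductive derivable :: "equation set \<Rightarrow> equation \<Rightarrow> bool" for E :: "equation set" where
  ax: "e \<in> E \<Longrightarrow> derivable E (subst_eq \<theta> \<tau> e)"
| refl_c: "derivable E (CEq t t)"
| sym_c: "derivable E (CEq t u) \<Longrightarrow> derivable E (CEq u t)"
| trans_c: "derivable E (CEq t u) \<Longrightarrow> derivable E (CEq u v) \<Longrightarrow> derivable E (CEq t v)"
| refl_s: "derivable E (SEq s s)"
| sym_s: "derivable E (SEq s r) \<Longrightarrow> derivable E (SEq r s)"
| trans_s: "derivable E (SEq s r) \<Longrightarrow> derivable E (SEq r q) \<Longrightarrow> derivable E (SEq s q)"
| cong: "derivable E (CEq t u) \<Longrightarrow> derivable E (SEq s r) \<Longrightarrow> derivable E (CEq (t \<cdot> s) (u \<cdot> r))"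

section \<open>The two axioms\<close>

definition idempotent_eq :: equation where
  "idempotent_eq = (let c = CVar 0; s = SVar 0 in CEq (c \<cdot> s \<cdot> s) (c \<cdot> s))"

definition previous_redundant_eq :: equation where
  "previous_redundant_eq =
     (let c = CVar 0; s = SVar 0; t = SVar 1 in CEq (c \<cdot> s \<cdot> t \<cdot> s) (c \<cdot> t \<cdot> s))"

end

theory Submission
  imports Defs
begin

text \<open>A term of sort \<open>C\<close> is a variable \<open>c\<close> followed by a word of variables of sort \<open>S\<close>. The two
  axioms together allow a letter to be erased whenever it occurs again later in the word
  (\<open>derivable_drop_earlier\<close>). If the two occurrences are adjacent, this is the idempotent equation;
  otherwise further copies of the letter are inserted between them, until the previous redundant
  equation, which skips one intermediate letter, applies to the earlier occurrence. Hence every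
  term is provably equal to one whose word has no repetition, obtained by keeping only the last
  occurrence of each letter; this is what \<open>remdups\<close> computes.

  Conversely, distinct repetition-free terms are already separated by the full action on a single
  point, in which an element of sort \<open>S\<close> switches the point on, switches it off or leaves it alone.
  Compare two distinct words from the right: just before their longest common suffix either two
  different letters stand, or one of the words is exhausted. Let one of these letters switch on, the
  other one (if any) switch off, and every other letter do nothing. As there are no repetitions, the
  common suffix acts trivially, so the results differ
  (\<open>words_eq_if_same_switching\<close>). Terms with different variables of sort \<open>C\<close>
  are separated by letting all letters do nothing. So an equation that holds in this one
  \<open>\<up>\<down>\<close>-action is derivable. The circle closes because the two axioms hold in all
  \<open>\<up>\<down>\<close>-actions and derivations are sound.\<close>

section \<open>Soundness\<close>

abbreviation updown_axioms :: "equation set" where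
  "updown_axioms \<equiv> {idempotent_eq, previous_redundant_eq}"

lemma satisfies_idempotent_eq:
  "satisfies A idempotent_eq \<longleftrightarrow>
     (\<forall>c\<in>carC A. \<forall>s\<in>carS A. act A (act A c s) s = act A c s)"
proof
  assume *: "satisfies A idempotent_eq"
  show "\<forall>c\<in>carC A. \<forall>s\<in>carS A. act A (act A c s) s = act A c s"
  proof (intro ballI)
    fix c s assume "c \<in> carC A" "s \<in> carS A"
    with *[unfolded satisfies_def, rule_format, of "\<lambda>_. c" "\<lambda>_. s"]
    show "act A (act A c s) s = act A c s" by (simp add: idempotent_eq_def Let_def)
  qed
qed (auto simp: satisfies_def idempotent_eq_def Let_def)

lemma satisfies_previous_redundant_eq:
  "satisfies A previous_redundant_eq \<longleftrightarrow>
     (\<forall>c\<in>carC A. \<forall>s\<in>carS A. \<forall>t\<in>carS A. act A (act A (act A c s) t) s = act A (act A c t) s)"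
proof
  assume *: "satisfies A previous_redundant_eq"
  show "\<forall>c\<in>carC A. \<forall>s\<in>carS A. \<forall>t\<in>carS A.
          act A (act A (act A c s) t) s = act A (act A c t) s"
  proof (intro ballI)
    fix c s t assume "c \<in> carC A" "s \<in> carS A" "t \<in> carS A"
    with *[unfolded satisfies_def, rule_format, of "\<lambda>_. c" "\<lambda>n. if n = 0 then s else t"]
    show "act A (act A (act A c s) t) s = act A (act A c t) s"
      by (simp add: previous_redundant_eq_def Let_def)
  qed
qed (auto simp: satisfies_def previous_redundant_eq_def Let_def)

text \<open>At each point of \<open>X\<close>, \<open>s\<close> either changes nothing or fixes the new value outright. In the first
  case an earlier \<open>s\<close> did nothing, in the second case its effect is overwritten.\<close>

lemma full_action_laws:
  assumes "s \<in> carS (full_action X)"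
  shows "act (full_action X) (act (full_action X) c s) s = act (full_action X) c s"
    and "act (full_action X) (act (full_action X) (act (full_action X) c s) t) s =
         act (full_action X) (act (full_action X) c t) s"
proof -
  obtain d u d' u' where "s = (d, u)" "t = (d', u')" by (cases s, cases t)
  with assms show "act (full_action X) (act (full_action X) c s) s = act (full_action X) c s"
    and "act (full_action X) (act (full_action X) (act (full_action X) c s) t) s =
         act (full_action X) (act (full_action X) c t) s"
    by (auto simp: full_action_def)
qed

lemma updown_action_satisfies_axioms:
  assumes "updown_action TYPE('x) A" and "d \<in> updown_axioms"
  shows "satisfies A d"
proof -
  from assms(1) have A: "is_action A" unfolding updown_action_def by blast
  from assms(1) obtain X :: "'x set" and B
    where B: "subaction B (full_action X)" and "action_iso A B"
    unfolding updown_action_def by blast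
  then obtain \<phi> \<psi>
    where bij: "bij_betw \<phi> (carC A) (carC B)" "bij_betw \<psi> (carS A) (carS B)"
      and hom: "\<forall>c\<in>carC A. \<forall>s\<in>carS A. \<phi> (act A c s) = act B (\<phi> c) (\<psi> s)"
    unfolding action_iso_def by blast
  note inj = bij_betw_imp_inj_on[OF bij(1)]
  note \<phi> = bij_betwE[OF bij(1), rule_format] and \<psi> = bij_betwE[OF bij(2), rule_format]
  let ?F = "full_action X"
  have closed: "act A c s \<in> carC A" if "c \<in> carC A" "s \<in> carS A" for c s
    using A that unfolding is_action_def by blast
  have hom': "\<phi> (act A c s) = act ?F (\<phi> c) (\<psi> s)" if "c \<in> carC A" "s \<in> carS A" for c s
    using B hom \<phi> \<psi> that unfolding subaction_def by simp
  have \<psi>': "\<psi> s \<in> carS ?F" if "s \<in> carS A" for s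
    using B \<psi> that unfolding subaction_def by blast
  have "satisfies A idempotent_eq"
    unfolding satisfies_idempotent_eq
  proof (intro ballI)
    fix c s assume cs: "c \<in> carC A" "s \<in> carS A"
    show "act A (act A c s) s = act A c s"
      by (rule inj_onD[OF inj]) (use cs in \<open>simp_all add: closed hom' \<psi>' full_action_laws\<close>)
  qed
  moreover have "satisfies A previous_redundant_eq"
    unfolding satisfies_previous_redundant_eq
  proof (intro ballI)
    fix c s t assume cst: "c \<in> carC A" "s \<in> carS A" "t \<in> carS A"
    show "act A (act A (act A c s) t) s = act A (act A c t) s"
      by (rule inj_onD[OF inj]) (use cst in \<open>simp_all add: closed hom' \<psi>' full_action_laws\<close>)
  qed
  ultimately show ?thesis using assms(2) by blast
qed

text \<open>Transitivity may pass through a term with other variables than those of its conclusion, and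
  these need not have values when a carrier is empty. For the two axioms this cannot happen, because
  both sides of each axiom have the same variables.\<close>

lemma derivable_same_vars:
  assumes "derivable updown_axioms e"
  shows "case e of CEq t u \<Rightarrow> cvars_c t = cvars_c u \<and> svars_c t = svars_c u | SEq s r \<Rightarrow> s = r"
  using assms
proof induction
  case (ax e \<theta> \<tau>)
  then show ?case by (auto simp: idempotent_eq_def previous_redundant_eq_def Let_def)
qed auto

lemma eval_s_in_carrier:
  "\<forall>y\<in>svars_s s. \<sigma> y \<in> carS A \<Longrightarrow> eval_s \<sigma> s \<in> carS A"
  by (cases s) simp

lemma eval_c_in_carrier:
  assumes "is_action A" "\<forall>x\<in>cvars_c t. \<rho> x \<in> carC A" "\<forall>y\<in>svars_c t. \<sigma> y \<in> carS A"
  shows "eval_c A \<rho> \<sigma> t \<in> carC A"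
  using assms by (induction t) (auto simp: is_action_def eval_s_in_carrier)

lemma derivable_sound:
  assumes "derivable updown_axioms e" and A: "is_action A" "\<forall>d\<in>updown_axioms. satisfies A d"
  shows "satisfies A e"
proof -
  have "holds_at A \<rho> \<sigma> e"
    if "\<forall>x\<in>cvars_eq e. \<rho> x \<in> carC A" "\<forall>y\<in>svars_eq e. \<sigma> y \<in> carS A" for \<rho> \<sigma>
    using assms(1) that
  proof induction
    case (ax e \<theta> \<tau>)
    have "satisfies A idempotent_eq" "satisfies A previous_redundant_eq"
      using A(2) by simp_all
    note laws = this[unfolded satisfies_idempotent_eq satisfies_previous_redundant_eq]
    from ax.hyps consider "e = idempotent_eq" | "e = previous_redundant_eq" by blast
    then show ?case
    proof cases
      case 1
      with ax.prems laws show ?thesis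
        by (simp add: idempotent_eq_def Let_def eval_c_in_carrier[OF A(1)] eval_s_in_carrier)
    next
      case 2
      with ax.prems laws show ?thesis
        by (simp add: previous_redundant_eq_def Let_def ball_Un
              eval_c_in_carrier[OF A(1)] eval_s_in_carrier)
    qed
  next
    case (trans_c t u v)
    from derivable_same_vars[OF trans_c.hyps(1)] derivable_same_vars[OF trans_c.hyps(2)]
    show ?case using trans_c.IH trans_c.prems by simp
  next
    case (trans_s s r q)
    from derivable_same_vars[OF trans_s.hyps(1)] derivable_same_vars[OF trans_s.hyps(2)]
    show ?case by simp
  qed (simp_all add: ball_Un)
  then show ?thesis unfolding satisfies_def by blast
qed

section \<open>Terms whose word has no repetition\<close>

abbreviation app_word :: "cterm \<Rightarrow> nat list \<Rightarrow> cterm" where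
  "app_word \<equiv> foldl (\<lambda>t y. t \<cdot> SVar y)"

lemma cterm_as_word: "\<exists>x ws. t = app_word (CVar x) ws"
proof (induction t)
  case (CVar x)
  then show ?case by (intro exI[of _ x] exI[of _ "[]"]) simp
next
  case (App t s)
  then obtain x ws where t: "t = app_word (CVar x) ws" by blast
  obtain y where "s = SVar y" by (cases s)
  with t show ?case by (intro exI[of _ x] exI[of _ "ws @ [y]"]) simp
qed

lemma eval_app_word:
  "eval_c A \<rho> \<sigma> (app_word t ws) = foldl (\<lambda>c y. act A c (\<sigma> y)) (eval_c A \<rho> \<sigma> t) ws"
  by (induction ws arbitrary: t) auto

lemma derivable_app_word_cong:
  "derivable E (CEq t u) \<Longrightarrow> derivable E (CEq (app_word t ws) (app_word u ws))"
  by (induction ws arbitrary: t u) (simp_all add: cong refl_s)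

lemma derivable_idempotent: "derivable updown_axioms (CEq (t \<cdot> s \<cdot> s) (t \<cdot> s))"
  using derivable.ax[of idempotent_eq updown_axioms "\<lambda>_. t" "\<lambda>_. s"]
  by (simp add: idempotent_eq_def Let_def)

lemma derivable_previous_redundant:
  "derivable updown_axioms (CEq (t \<cdot> s \<cdot> r \<cdot> s) (t \<cdot> r \<cdot> s))"
  using derivable.ax[of previous_redundant_eq updown_axioms "\<lambda>_. t" "\<lambda>n. if n = 0 then s else r"]
  by (simp add: previous_redundant_eq_def Let_def)

text \<open>The two occurrences of \<open>y\<close> may be separated by any word. If the letter after the first one is
  \<open>z \<noteq> y\<close>, the induction hypothesis, read backwards, inserts a further \<open>y\<close> after \<open>z\<close>; this makes
  the first \<open>y\<close> redundant by the axiom, and the inserted one is then removed again by the induction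
  hypothesis.\<close>

lemma derivable_drop_earlier:
  assumes "y \<in> set ws"
  shows "derivable updown_axioms (CEq (app_word t (y # ws)) (app_word t ws))"
  using assms
proof (induction ws arbitrary: t)
  case (Cons z ws)
  show ?case
  proof (cases "z = y")
    case True
    then show ?thesis
      using derivable_app_word_cong[OF derivable_idempotent, of t "SVar y" ws] by simp
  next
    case False
    with Cons.prems have y: "y \<in> set ws" by simp
    let ?y = "SVar y" and ?z = "SVar z"
    have "derivable updown_axioms (CEq (app_word (t \<cdot> ?y \<cdot> ?z) ws) (app_word (t \<cdot> ?y \<cdot> ?z \<cdot> ?y) ws))"
      using Cons.IH[OF y, of "t \<cdot> ?y \<cdot> ?z"] by (auto intro: sym_c)
    moreover have
      "derivable updown_axioms (CEq (app_word (t \<cdot> ?y \<cdot> ?z \<cdot> ?y) ws) (app_word (t \<cdot> ?z \<cdot> ?y) ws))"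
      by (rule derivable_app_word_cong[OF derivable_previous_redundant])
    moreover have "derivable updown_axioms (CEq (app_word (t \<cdot> ?z \<cdot> ?y) ws) (app_word (t \<cdot> ?z) ws))"
      using Cons.IH[OF y, of "t \<cdot> ?z"] by simp
    ultimately show ?thesis by (auto intro: trans_c)
  qed
qed simp

lemma derivable_remdups:
  "derivable updown_axioms (CEq (app_word t ws) (app_word t (remdups ws)))"
proof (induction ws arbitrary: t)
  case (Cons y ws)
  show ?case
  proof (cases "y \<in> set ws")
    case True
    with trans_c[OF derivable_drop_earlier Cons.IH] show ?thesis by simp
  next
    case False
    with Cons.IH[of "t \<cdot> SVar y"] show ?thesis by simp
  qed
qed (simp add: refl_c)

section \<open>The action on a single point\<close>

text \<open>For distinct arguments this is a copy of the full action on a one-point set \<open>X\<close>: \<open>on\<close> and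
  \<open>off\<close> stand for \<open>X\<close> and \<open>{}\<close>, and \<open>up\<close>, \<open>down\<close>, \<open>skip\<close> for the pairs \<open>(X, X)\<close>, \<open>({}, {})\<close>,
  \<open>(X, {})\<close>. The elements are parameters so that the copy can live on the given types of the
  carriers.\<close>

definition switch_action :: "'c \<Rightarrow> 'c \<Rightarrow> 's \<Rightarrow> 's \<Rightarrow> 's \<Rightarrow> ('c, 's) action" where
  "switch_action on off up down skip =
     \<lparr>carC = {on, off}, carS = {up, down, skip},
      act = (\<lambda>c s. if s = up then on else if s = down then off else c)\<rparr>"

lemma updown_action_switch_action:
  assumes "on \<noteq> off" and "distinct [up, down, skip]"
  shows "updown_action TYPE('x) (switch_action on off up down skip)"
proof -
  let ?A = "switch_action on off up down skip"
  fix p :: 'x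
  let ?F = "full_action {p}"
  define \<phi> where "\<phi> c = (if c = on then {p} else {})" for c
  define \<psi> where "\<psi> s =
    (if s = up then ({p}, {p}) else if s = down then ({}, {}) else ({p}, {}))" for s
  have carS: "carS ?F = {({p}, {p}), ({}, {}), ({p}, {})}"
    by (auto simp: full_action_def subset_singleton_iff)
  have "bij_betw \<phi> (carC ?A) (carC ?F)"
    using assms
    by (auto simp: bij_betw_def inj_on_def \<phi>_def switch_action_def full_action_def Pow_insert)
  moreover have "bij_betw \<psi> (carS ?A) (carS ?F)"
    using assms by (auto simp: bij_betw_def inj_on_def \<psi>_def switch_action_def carS)
  moreover have "\<forall>c\<in>carC ?A. \<forall>s\<in>carS ?A. \<phi> (act ?A c s) = act ?F (\<phi> c) (\<psi> s)"
    using assms by (auto simp: \<phi>_def \<psi>_def switch_action_def full_action_def)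
  ultimately have "action_iso ?A ?F" unfolding action_iso_def by blast
  moreover have "subaction ?F ?F"
    by (auto simp: subaction_def is_action_def full_action_def)
  moreover have "is_action ?A" by (auto simp: is_action_def switch_action_def)
  ultimately show ?thesis unfolding updown_action_def by blast
qed

lemma switch_action_skip:
  assumes "distinct [up, down, skip]" and "\<forall>y\<in>set ws. \<sigma> y = skip"
  shows "foldl (\<lambda>c y. act (switch_action on off up down skip) c (\<sigma> y)) c ws = c"
  using assms by (induction ws) (auto simp: switch_action_def)

text \<open>Since letters do not repeat, a common last letter can be made to do nothing without affecting
  the rest of the words, which lets the induction strip the common suffix. Starting from \<open>off\<close>, a
  letter that switches on is visible even against the empty word.\<close>

lemma words_eq_if_same_switching:
  fixes on off :: 'c and up down skip :: 's and us vs :: "'a list"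
  defines "A \<equiv> switch_action on off up down skip"
  assumes ne: "on \<noteq> off" "distinct [up, down, skip]"
    and "distinct us" "distinct vs"
    and "\<And>\<sigma>. range \<sigma> \<subseteq> carS A \<Longrightarrow>
           foldl (\<lambda>c y. act A c (\<sigma> y)) off us = foldl (\<lambda>c y. act A c (\<sigma> y)) off vs"
  shows "us = vs"
  using assms(4-)
proof (induction us arbitrary: vs rule: rev_induct)
  case Nil
  show ?case
  proof (cases vs rule: rev_cases)
    case (snoc vs' b)
    with Nil.prems(3)[of "\<lambda>_. up"] ne show ?thesis by (simp add: A_def switch_action_def)
  qed simp
next
  case (snoc a us)
  show ?case
  proof (cases vs rule: rev_cases)
    case Nil
    with snoc.prems(3)[of "\<lambda>_. up"] ne show ?thesis by (simp add: A_def switch_action_def)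
  next
    case vs: (snoc vs' b)
    have "a = b"
    proof (rule ccontr)
      assume "a \<noteq> b"
      let ?\<sigma> = "\<lambda>y. if y = a then up else down"
      have "range ?\<sigma> \<subseteq> carS A" by (auto simp: A_def switch_action_def)
      from snoc.prems(3)[OF this] vs \<open>a \<noteq> b\<close> ne show False
        by (auto simp: A_def switch_action_def)
    qed
    have "us = vs'"
    proof (rule snoc.IH)
      fix \<sigma> :: "'a \<Rightarrow> 's"
      assume \<sigma>: "range \<sigma> \<subseteq> carS A"
      let ?\<sigma> = "\<sigma>(a := skip)"
      have "range ?\<sigma> \<subseteq> carS A" using \<sigma> by (auto simp: A_def switch_action_def)
      from snoc.prems(3)[OF this] vs \<open>a = b\<close> ne
      have "foldl (\<lambda>c y. act A c (?\<sigma> y)) off us = foldl (\<lambda>c y. act A c (?\<sigma> y)) off vs'"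
        by (auto simp: A_def switch_action_def)
      moreover have "foldl (\<lambda>c y. act A c (?\<sigma> y)) off ws = foldl (\<lambda>c y. act A c (\<sigma> y)) off ws"
        if "a \<notin> set ws" for ws
        using that by (intro foldl_cong) auto
      ultimately show "foldl (\<lambda>c y. act A c (\<sigma> y)) off us = foldl (\<lambda>c y. act A c (\<sigma> y)) off vs'"
        using snoc.prems(1,2) vs \<open>a = b\<close> by simp
    qed (use snoc.prems vs in simp_all)
    with vs \<open>a = b\<close> show ?thesis by simp
  qed
qed

section \<open>Completeness\<close>

lemma derivable_if_switch_action_satisfies:
  fixes on off :: 'c and up down skip :: 's
  defines "A \<equiv> switch_action on off up down skip"
  assumes ne: "on \<noteq> off" "distinct [up, down, skip]" and sat: "satisfies A e"
  shows "derivable updown_axioms e"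
proof (cases e)
  case (SEq s r)
  obtain y z where e: "e = SEq (SVar y) (SVar z)" using SEq by (metis sterm.exhaust)
  let ?\<sigma> = "\<lambda>v. if v = y then up else down"
  have "(\<forall>x\<in>cvars_eq e. off \<in> carC A) \<longrightarrow> (\<forall>v\<in>svars_eq e. ?\<sigma> v \<in> carS A) \<longrightarrow>
      holds_at A (\<lambda>_. off) ?\<sigma> e"
    using sat unfolding satisfies_def by (elim allE)
  then have "y = z"
    using ne by (auto simp: e A_def switch_action_def split: if_splits)
  then show ?thesis by (simp add: e refl_s)
next
  case (CEq t u)
  obtain x us where t: "t = app_word (CVar x) us" using cterm_as_word by blast
  obtain z vs where u: "u = app_word (CVar z) vs" using cterm_as_word by blast
  let ?t = "app_word (CVar x) (remdups us)" and ?u = "app_word (CVar z) (remdups vs)"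
  have updown: "updown_action TYPE(unit) A"
    unfolding A_def using ne by (rule updown_action_switch_action)
  have sound: "satisfies A d" if "derivable updown_axioms d" for d
    using derivable_sound[OF that] updown updown_action_satisfies_axioms[OF updown]
    unfolding updown_action_def by blast
  have same: "eval_c A \<rho> \<sigma> ?t = eval_c A \<rho> \<sigma> ?u"
    if "range \<rho> \<subseteq> carC A" "range \<sigma> \<subseteq> carS A" for \<rho> \<sigma>
  proof -
    have *: "holds_at A \<rho> \<sigma> d" if "satisfies A d" for d
      using that \<open>range \<rho> \<subseteq> carC A\<close> \<open>range \<sigma> \<subseteq> carS A\<close> unfolding satisfies_def by blast
    from *[OF sound[OF derivable_remdups]] *[OF sat]
    show ?thesis by (simp add: CEq t u)
  qed
  have "x = z"
  proof -
    let ?\<rho> = "\<lambda>v. if v = x then on else off" and ?\<sigma> = "\<lambda>_. skip"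
    have "range ?\<rho> \<subseteq> carC A" "range ?\<sigma> \<subseteq> carS A" by (auto simp: A_def switch_action_def)
    from same[OF this] ne show ?thesis
      by (simp add: A_def eval_app_word switch_action_skip split: if_splits)
  qed
  moreover have "remdups us = remdups vs"
  proof (rule words_eq_if_same_switching[OF ne])
    fix \<sigma> :: "nat \<Rightarrow> 's"
    assume "range \<sigma> \<subseteq> carS (switch_action on off up down skip)"
    with same[of "\<lambda>_. off" \<sigma>]
    show "foldl (\<lambda>c y. act (switch_action on off up down skip) c (\<sigma> y)) off (remdups us) =
          foldl (\<lambda>c y. act (switch_action on off up down skip) c (\<sigma> y)) off (remdups vs)"
      by (simp add: eval_app_word A_def) (simp add: switch_action_def)
  qed simp_all
  ultimately have "derivable updown_axioms (CEq ?t u)"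
    unfolding u using sym_c[OF derivable_remdups[of "CVar z" vs]] by simp
  with derivable_remdups[of "CVar x" us] show ?thesis
    unfolding CEq t by (rule trans_c)
qed

lemma updown_valid_imp_derivable:
  assumes "infinite (UNIV :: 'c set)" and "infinite (UNIV :: 's set)"
    and "updown_valid TYPE('x) TYPE('c) TYPE('s) e"
  shows "derivable updown_axioms e"
proof -
  obtain C :: "'c set" where "card C = 2"
    using infinite_arbitrarily_large[OF assms(1)] by blast
  then obtain on off :: 'c where C: "on \<noteq> off" by (auto simp: card_2_iff)
  obtain S :: "'s set" where "card S = 3"
    using infinite_arbitrarily_large[OF assms(2)] by blast
  then obtain up down skip :: 's where S: "distinct [up, down, skip]"
    by (auto simp: card_3_iff)
  show ?thesis
    using derivable_if_switch_action_satisfies[OF C S] updown_action_switch_action[OF C S] assms(3)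
    unfolding updown_valid_def by blast
qed

theorem proposition4p6:
  fixes e :: equation
  assumes "infinite (UNIV :: 'x set)"
    and "infinite (UNIV :: 'c set)"
    and "infinite (UNIV :: 's set)"
  shows "(updown_valid TYPE('x) TYPE('c) TYPE('s) e \<longleftrightarrow>
            semantic_consequence TYPE('c) TYPE('s) {idempotent_eq, previous_redundant_eq} e) \<and>
         (updown_valid TYPE('x) TYPE('c) TYPE('s) e \<longleftrightarrow>
            derivable {idempotent_eq, previous_redundant_eq} e)"
proof -
  have "semantic_consequence TYPE('c) TYPE('s) updown_axioms e"
    if "derivable updown_axioms e"
    using derivable_sound[OF that] unfolding semantic_consequence_def by blast
  moreover have "updown_valid TYPE('x) TYPE('c) TYPE('s) e"
    if "semantic_consequence TYPE('c) TYPE('s) updown_axioms e"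
    using that updown_action_satisfies_axioms[where 'x = 'x]
    unfolding semantic_consequence_def updown_valid_def updown_action_def by blast
  ultimately show ?thesis
    using updown_valid_imp_derivable[OF assms(2,3)] by blast
qed

end
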